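(* Let $d$ be a positive integer such that there exists a Hadamard matrix of order $4d$. Then $$N((1,1;d),4d-1)=4d-1.$$
   Context: A Hadamard matrix of order $n$ is an $n\times n$ matrix $H$ with entries $+1$ and $-1$ such that $HH^{T}=nI$. Write $[t]=\{1,\dots,t\}$. A set system $(X,\mathcal B)$ with $|X|=n$ and an indexed family of blocks $\mathcal B=\{B_1,\dots,B_t\}$ of subsets of $X$ is an $(r,w;d)-CFF(n,t)$ (cover-free family) if for all $L,M\subseteq[t]$ with $L\cap M=\varnothing$, $|L|=r$, $|M|=w$, we have $\left|\left(\bigcap_{l\in L}B_l\right)\setminus\left(\bigcup_{m\in M}B_m\right)\right|\ge d$. $N((r,w;d),t)$ denotes the minimum $n$ for which an $(r,w;d)-CFF(n,t)$ exists. *)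

theory Defs
  imports "Jordan_Normal_Form.Matrix"
begin

definition hadamard_matrix :: "nat \<Rightarrow> int mat \<Rightarrow> bool" where
  "hadamard_matrix n H \<longleftrightarrow>
     H \<in> carrier_mat n n \<and> (\<forall>i<n. \<forall>j<n. H $$ (i, j) \<in> {1, -1}) \<and>
     H * transpose_mat H = int n \<cdot>\<^sub>m 1\<^sub>m n"

(* Blocks form a family indexed by 1, ..., t, so repetitions are allowed. The intersection
   with X only matters for empty L (r = 0), where the intersection of no blocks is X and
   not the whole type. *)
definition cover_free_family ::
    "nat \<Rightarrow> nat \<Rightarrow> nat \<Rightarrow> nat \<Rightarrow> nat \<Rightarrow> 'a set \<Rightarrow> (nat \<Rightarrow> 'a set) \<Rightarrow> bool" where
  "cover_free_family r w d n t X B \<longleftrightarrow>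
     finite X \<and> card X = n \<and> (\<forall>i\<in>{1..t}. B i \<subseteq> X) \<and>
     (\<forall>L M. L \<subseteq> {1..t} \<and> M \<subseteq> {1..t} \<and> L \<inter> M = {} \<and> card L = r \<and> card M = w \<longrightarrow>
        d \<le> card ((X \<inter> (\<Inter>l\<in>L. B l)) - (\<Union>m\<in>M. B m)))"

(* Points are taken in nat; by cover_free_family_nat this loses no generality, and by
   ex_cover_free_family the minimum is always over a nonempty set. *)
definition cff_number :: "nat \<Rightarrow> nat \<Rightarrow> nat \<Rightarrow> nat \<Rightarrow> nat" where
  "cff_number r w d t =
     (LEAST n. \<exists>(X :: nat set) B. cover_free_family r w d n t X B)"

lemma cover_free_family_nat:
  fixes X :: "'a set"
  assumes "cover_free_family r w d n t X B"
  shows "\<exists>(Y :: nat set) C. cover_free_family r w d n t Y C"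
proof -
  have fin: "finite X" and n: "card X = n" and BX: "\<And>i. i \<in> {1..t} \<Longrightarrow> B i \<subseteq> X"
    using assms unfolding cover_free_family_def by auto
  obtain f :: "'a \<Rightarrow> nat" where inj: "inj_on f X"
    using finite_imp_inj_to_nat_seg[OF fin] by blast
  have "d \<le> card ((f ` X \<inter> (\<Inter>l\<in>L. f ` B l)) - (\<Union>m\<in>M. f ` B m))"
    if LM: "L \<subseteq> {1..t}" "M \<subseteq> {1..t}" "L \<inter> M = {}" "card L = r" "card M = w" for L M
  proof -
    let ?S = "(X \<inter> (\<Inter>l\<in>L. B l)) - (\<Union>m\<in>M. B m)"
    let ?T = "(f ` X \<inter> (\<Inter>l\<in>L. f ` B l)) - (\<Union>m\<in>M. f ` B m)"
    have mem: "f x \<in> f ` B i \<longleftrightarrow> x \<in> B i" if "x \<in> X" "i \<in> {1..t}" for x i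
      using inj_on_image_mem_iff[OF inj that(1) BX[OF that(2)]] .
    have "f ` ?S \<subseteq> ?T"
    proof
      fix y assume "y \<in> f ` ?S"
      then obtain x where x: "y = f x" "x \<in> X" "\<And>l. l \<in> L \<Longrightarrow> x \<in> B l" "\<And>m. m \<in> M \<Longrightarrow> x \<notin> B m"
        by blast
      have "y \<notin> f ` B m" if "m \<in> M" for m
        using mem[OF x(2) subsetD[OF LM(2) that]] x(4)[OF that] unfolding x(1) by simp
      moreover have "y \<in> f ` B l" if "l \<in> L" for l
        using x(3)[OF that] unfolding x(1) by (rule imageI)
      moreover have "y \<in> f ` X"
        using x(2) unfolding x(1) by (rule imageI)
      ultimately show "y \<in> ?T" by simp
    qed
    then have "card (f ` ?S) \<le> card ?T"
      using fin by (intro card_mono) auto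
    moreover have "card (f ` ?S) = card ?S"
      by (rule card_image, rule inj_on_subset[OF inj]) blast
    moreover have "d \<le> card ?S"
      using assms LM unfolding cover_free_family_def by simp
    ultimately show ?thesis by linarith
  qed
  then have "cover_free_family r w d n t (f ` X) (\<lambda>i. f ` B i)"
    using fin n card_image[OF inj] image_mono[OF BX] unfolding cover_free_family_def
    by (intro conjI allI ballI impI; simp)
  then show ?thesis by blast
qed

lemma ex_cover_free_family:
  "\<exists>n (X :: nat set) B. cover_free_family r w d n t X B"
proof -
  let ?X = "Pow {1..t} \<times> {..<d}"
  let ?B = "\<lambda>i. {p \<in> ?X. i \<in> fst p}"
  have "d \<le> card ((?X \<inter> (\<Inter>l\<in>L. ?B l)) - (\<Union>m\<in>M. ?B m))"
    if "L \<subseteq> {1..t}" "L \<inter> M = {}" for L M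
  proof -
    have "{L} \<times> {..<d} \<subseteq> (?X \<inter> (\<Inter>l\<in>L. ?B l)) - (\<Union>m\<in>M. ?B m)"
      using that by auto
    then have "card ({L} \<times> {..<d}) \<le> card ((?X \<inter> (\<Inter>l\<in>L. ?B l)) - (\<Union>m\<in>M. ?B m))"
      by (intro card_mono) auto
    then show ?thesis by (simp add: card_cartesian_product)
  qed
  then have "cover_free_family r w d (card ?X) t ?X ?B"
    unfolding cover_free_family_def by (intro conjI allI impI) (simp, simp, blast, simp)
  then show ?thesis using cover_free_family_nat by blast
qed

end

theory Submission
  imports Defs
begin

text \<open>
  For single-element index sets the cover-free property says that every ordered pair of distinct
  blocks satisfies \<open>d \<le> card (B i - B j)\<close>. The indicator vectors of the blocks thus form a code with
  a one-sided distance condition; the lower bound is the averaging argument of the Plotkin bound,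
  and the codes obtained from Hadamard matrices attain it.

  \<^emph>\<open>Lower bound.\<close> Count the triples \<open>(i, j, x)\<close> with \<open>x \<in> B i - B j\<close>. There are at least
  \<open>d * t * (t - 1)\<close> of them. A point lying in exactly \<open>k\<close> blocks contributes \<open>k * (t - k)\<close>, which
  for odd \<open>t\<close> is at most \<open>(t - 1) * (t + 1) / 4\<close>. Hence \<open>4 * d * t \<le> n * (t + 1)\<close>, which for
  \<open>t = 4 * d - 1\<close> is \<open>t \<le> n\<close> (lemma \<open>cover_free_family_1_1_lower_bound\<close>).

  \<^emph>\<open>Construction.\<close> Rescale the rows and columns of a Hadamard matrix by signs so that row 0
  and column 0 consist of ones. The other rows, read as indicator vectors of
  their positive entries, are the blocks. Since rows 0, \<open>i\<close> and \<open>k\<close> are pairwise orthogonal, each of the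
  four sign patterns in rows \<open>i\<close> and \<open>k\<close> occurs in exactly \<open>d\<close> columns, so \<open>B i - B k\<close> has \<open>d\<close>
  elements. Column 0 lies in every block and therefore in no difference, so it may be deleted,
  which leaves \<open>4 * d - 1\<close> points (lemma \<open>hadamard_matrix_cover_free_family\<close>).
\<close>

lemma cover_free_family_1_1_iff:
  "cover_free_family 1 1 d n t X B \<longleftrightarrow>
     finite X \<and> card X = n \<and> (\<forall>i\<in>{1..t}. B i \<subseteq> X) \<and>
     (\<forall>i\<in>{1..t}. \<forall>j\<in>{1..t}. i \<noteq> j \<longrightarrow> d \<le> card (B i - B j))"
  (is "_ \<longleftrightarrow> ?fin \<and> ?card \<and> ?sub \<and> ?diff")
proof -
  have eq: "(\<forall>L M. L \<subseteq> {1..t} \<and> M \<subseteq> {1..t} \<and> L \<inter> M = {} \<and> card L = 1 \<and> card M = 1 \<longrightarrow>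
          d \<le> card ((X \<inter> (\<Inter>l\<in>L. B l)) - (\<Union>m\<in>M. B m))) \<longleftrightarrow> ?diff" (is "?cf \<longleftrightarrow> _")
    if ?sub
  proof
    assume cf: ?cf
    show ?diff
    proof (intro ballI impI)
      fix i j assume ij: "i \<in> {1..t}" "j \<in> {1..t}" "i \<noteq> j"
      have "d \<le> card ((X \<inter> (\<Inter>l\<in>{i}. B l)) - (\<Union>m\<in>{j}. B m))"
        by (rule cf[rule_format]) (use ij in auto)
      moreover have "X \<inter> B i = B i"
        using that ij by blast
      ultimately show "d \<le> card (B i - B j)" by simp
    qed
  next
    assume diff: ?diff
    show ?cf
    proof (intro allI impI, elim conjE)
      fix L M assume LM: "L \<subseteq> {1..t}" "M \<subseteq> {1..t}" "L \<inter> M = {}" "card L = 1" "card M = 1"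
      then obtain i j where [simp]: "L = {i}" "M = {j}"
        by (metis card_1_singletonE)
      have ij: "i \<in> {1..t}" "j \<in> {1..t}" "i \<noteq> j"
        using LM by auto
      then have "X \<inter> B i = B i"
        using that by blast
      then show "d \<le> card ((X \<inter> (\<Inter>l\<in>L. B l)) - (\<Union>m\<in>M. B m))"
        using diff ij by simp
    qed
  qed
  show ?thesis
    unfolding cover_free_family_def by (intro conj_cong refl eq)
qed

text \<open>Both sides count the triples \<open>(i, j, x)\<close> with \<open>x \<in> B i - B j\<close>.\<close>

lemma sum_card_Diff_double_count:
  assumes "finite X" "finite I" "\<And>i. i \<in> I \<Longrightarrow> B i \<subseteq> X"
  shows "(\<Sum>i\<in>I. \<Sum>j\<in>I. card (B i - B j)) =
         (\<Sum>x\<in>X. card {i\<in>I. x \<in> B i} * card {j\<in>I. x \<notin> B j})"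
proof -
  have "card (B i - B j) = (\<Sum>x\<in>X. of_bool (x \<in> B i) * of_bool (x \<notin> B j))"
    if "i \<in> I" for i j
  proof -
    have "B i - B j = {x\<in>X. x \<in> B i \<and> x \<notin> B j}"
      using assms(3)[OF that] by blast
    then show ?thesis
      using assms(1) by (simp add: sum_of_bool_eq Collect_conj_eq flip: of_bool_conj)
  qed
  then have "(\<Sum>i\<in>I. \<Sum>j\<in>I. card (B i - B j)) =
        (\<Sum>i\<in>I. \<Sum>j\<in>I. \<Sum>x\<in>X. of_bool (x \<in> B i) * of_bool (x \<notin> B j))"
    by simp
  also have "\<dots> = (\<Sum>i\<in>I. \<Sum>x\<in>X. \<Sum>j\<in>I. of_bool (x \<in> B i) * of_bool (x \<notin> B j))"
    by (intro sum.cong refl sum.swap)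
  also have "\<dots> = (\<Sum>x\<in>X. \<Sum>i\<in>I. \<Sum>j\<in>I. of_bool (x \<in> B i) * of_bool (x \<notin> B j))"
    by (rule sum.swap)
  also have "\<dots> = (\<Sum>x\<in>X. (\<Sum>i\<in>I. of_bool (x \<in> B i)) * (\<Sum>j\<in>I. of_bool (x \<notin> B j)))"
    by (simp only: sum_product)
  also have "\<dots> = (\<Sum>x\<in>X. card {i\<in>I. x \<in> B i} * card {j\<in>I. x \<notin> B j})"
    using assms(2) by (simp add: sum_of_bool_eq Collect_conj_eq)
  finally show ?thesis .
qed

text \<open>The difference \<open>a - b\<close> is odd, so \<open>4 * a * b = (a + b)\<^sup>2 - (a - b)\<^sup>2\<close> is at most
  \<open>(a + b)\<^sup>2 - 1\<close>. The gain of 1 over the inequality of the means makes the bound sharp below.\<close>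

lemma four_mult_le_of_odd_add:
  fixes a b :: nat
  assumes "odd (a + b)"
  shows "4 * (a * b) \<le> (a + b - 1) * (a + b + 1)"
proof -
  have "int a - int b \<noteq> 0"
    using assms by auto
  then have "1 \<le> (int a - int b)\<^sup>2"
    by (simp add: int_one_le_iff_zero_less)
  then have "4 * (int a * int b) \<le> (int a + int b - 1) * (int a + int b + 1)"
    by (simp add: power2_eq_square algebra_simps)
  moreover have "int (a + b - 1) = int a + int b - 1"
    using odd_pos[OF assms] by linarith
  ultimately have "int (4 * (a * b)) \<le> int ((a + b - 1) * (a + b + 1))"
    by (simp only: of_nat_mult of_nat_add of_nat_numeral of_nat_1)
  then show ?thesis
    by (simp only: of_nat_le_iff)
qed

lemma cover_free_family_1_1_lower_bound:
  assumes cf: "cover_free_family 1 1 d n t X B" and t: "odd t" "1 < t"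
  shows "4 * d * t \<le> n * (t + 1)"
proof -
  define I where "I = {1..t}"
  have X: "finite X" "card X = n" and sub: "\<And>i. i \<in> I \<Longrightarrow> B i \<subseteq> X"
    and diff: "\<And>i j. i \<in> I \<Longrightarrow> j \<in> I \<Longrightarrow> i \<noteq> j \<Longrightarrow> d \<le> card (B i - B j)"
    using cf unfolding cover_free_family_1_1_iff I_def by auto
  have I: "finite I" "card I = t"
    by (simp_all add: I_def)
  have "t * ((t - 1) * d) = (\<Sum>i\<in>I. \<Sum>j\<in>I - {i}. d)"
    using I by simp
  also have "\<dots> \<le> (\<Sum>i\<in>I. \<Sum>j\<in>I - {i}. card (B i - B j))"
    by (intro sum_mono diff) auto
  also have "\<dots> \<le> (\<Sum>i\<in>I. \<Sum>j\<in>I. card (B i - B j))"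
    using I by (intro sum_mono sum_mono2) auto
  also have "\<dots> = (\<Sum>x\<in>X. card {i\<in>I. x \<in> B i} * card {j\<in>I. x \<notin> B j})"
    by (rule sum_card_Diff_double_count[OF X(1) I(1) sub])
  finally have "4 * (t * ((t - 1) * d)) \<le>
      (\<Sum>x\<in>X. 4 * (card {i\<in>I. x \<in> B i} * card {j\<in>I. x \<notin> B j}))"
    by (simp flip: sum_distrib_left)
  also have "\<dots> \<le> (\<Sum>x\<in>X. (t - 1) * (t + 1))"
  proof (rule sum_mono)
    fix x
    have "card {i\<in>I. x \<in> B i} + card {j\<in>I. x \<notin> B j} = card ({i\<in>I. x \<in> B i} \<union> {j\<in>I. x \<notin> B j})"
      using I by (subst card_Un_disjoint) auto
    also have "{i\<in>I. x \<in> B i} \<union> {j\<in>I. x \<notin> B j} = I"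
      by blast
    finally show "4 * (card {i\<in>I. x \<in> B i} * card {j\<in>I. x \<notin> B j}) \<le> (t - 1) * (t + 1)"
      using four_mult_le_of_odd_add t(1) I(2) by metis
  qed
  also have "\<dots> = (t - 1) * (n * (t + 1))"
    using X(2) by (simp only: sum_constant of_nat_id mult_ac)
  finally have "(t - 1) * (4 * d * t) \<le> (t - 1) * (n * (t + 1))"
    by (simp only: mult_ac)
  then show ?thesis
    using t(2) by simp
qed

lemma hadamard_matrix_rows_orthogonal:
  assumes "hadamard_matrix n H" "i < n" "k < n" "i \<noteq> k"
  shows "(\<Sum>j<n. H $$ (i, j) * H $$ (k, j)) = 0"
proof -
  have H: "H \<in> carrier_mat n n" and eq: "H * transpose_mat H = int n \<cdot>\<^sub>m 1\<^sub>m n"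
    using assms(1) by (auto simp: hadamard_matrix_def)
  have "(H * transpose_mat H) $$ (i, k) = (\<Sum>j<n. H $$ (i, j) * H $$ (k, j))"
    using H assms(2,3) by (auto simp: scalar_prod_def lessThan_atLeast0 intro!: sum.cong)
  moreover have "(H * transpose_mat H) $$ (i, k) = 0"
    unfolding eq using assms(2-4) by simp
  ultimately show ?thesis by simp
qed

lemma hadamard_matrix_cover_free_family:
  assumes d: "d > 0" and H: "hadamard_matrix (4 * d) H"
  shows "\<exists>(X :: nat set) B. cover_free_family 1 1 d (4 * d - 1) (4 * d - 1) X B"
proof -
  (* Multiplying column j by its entry in row 0, and then row i by the resulting entry in
     column 0, turns row 0 and column 0 into ones. *)
  define G where "G i j = H $$ (i, j) * H $$ (0, j) * (H $$ (i, 0) * H $$ (0, 0))" for i j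
  define B where "B i = {j \<in> {1..<4*d}. G i j = 1}" for i
  have H_sign: "H $$ (i, j) = 1 \<or> H $$ (i, j) = -1" if "i < 4*d" "j < 4*d" for i j
    using H that by (auto simp: hadamard_matrix_def)
  have sq: "H $$ (i, j) * H $$ (i, j) = 1" if "i < 4*d" "j < 4*d" for i j
    using H_sign[OF that] by auto
  have G_sign: "G i j = 1 \<or> G i j = -1" if "i < 4*d" "j < 4*d" for i j
    using H_sign[of i j] H_sign[of 0 j] H_sign[of i 0] H_sign[of 0 0] that
    unfolding G_def by auto
  have G_col0: "G i 0 = 1" if "i < 4*d" for i
    using H_sign[of i 0] H_sign[of 0 0] that unfolding G_def by auto
  have G_sum: "(\<Sum>j<4*d. G i j) = 0" if "i < 4*d" "i \<noteq> 0" for i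
    using hadamard_matrix_rows_orthogonal[OF H, of i 0] that
    unfolding G_def by (simp flip: sum_distrib_right)
  have G_orth: "(\<Sum>j<4*d. G i j * G k j) = 0" if ik: "i < 4*d" "k < 4*d" "i \<noteq> k" for i k
  proof -
    have "(\<Sum>j<4*d. G i j * G k j) =
        (\<Sum>j<4*d. H $$ (i, j) * H $$ (k, j) * (H $$ (i, 0) * H $$ (k, 0)))"
    proof (intro sum.cong refl)
      fix j assume "j \<in> {..<4*d}"
      have "G i j * G k j = H $$ (i, j) * H $$ (k, j) * (H $$ (i, 0) * H $$ (k, 0))
          * (H $$ (0, j) * H $$ (0, j)) * (H $$ (0, 0) * H $$ (0, 0))"
        unfolding G_def by (simp only: mult_ac)
      then show "G i j * G k j = H $$ (i, j) * H $$ (k, j) * (H $$ (i, 0) * H $$ (k, 0))"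
        using sq[of 0 j] sq[of 0 0] \<open>j \<in> {..<4*d}\<close> d by simp
    qed
    then show ?thesis
      using hadamard_matrix_rows_orthogonal[OF H ik] by (simp flip: sum_distrib_right)
  qed
  have "card (B i - B k) = d" if ik: "i \<in> {1..4*d-1}" "k \<in> {1..4*d-1}" "i \<noteq> k" for i k
  proof -
    have lt: "i < 4*d" "k < 4*d" "i \<noteq> 0" "k \<noteq> 0"
      using ik by auto
    (* The product (1 + G i j) * (1 - G k j) is 4 times the indicator of B i - B k,
       also at the deleted point j = 0, where its second factor is zero. *)
    have "4 * int (card (B i - B k)) = (\<Sum>j\<in>B i - B k. 4)"
      by simp
    also have "\<dots> = (\<Sum>j\<in>B i - B k. (1 + G i j) * (1 - G k j))"
    proof (intro sum.cong refl)
      fix j assume "j \<in> B i - B k"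
      then have "G i j = 1" "G k j = -1"
        using G_sign[of k j] lt by (auto simp: B_def)
      then show "4 = (1 + G i j) * (1 - G k j)" by simp
    qed
    also have "\<dots> = (\<Sum>j<4*d. (1 + G i j) * (1 - G k j))"
    proof (intro sum.mono_neutral_left ballI)
      fix j assume j: "j \<in> {..<4*d} - (B i - B k)"
      show "(1 + G i j) * (1 - G k j) = 0"
      proof (cases "j = 0")
        case True
        then show ?thesis using G_col0 lt by simp
      next
        case False
        then show ?thesis using j G_sign[of i j] lt by (auto simp: B_def)
      qed
    qed (auto simp: B_def)
    also have "\<dots> = (\<Sum>j<4*d. 1 + G i j - G k j - G i j * G k j)"
      by (simp add: algebra_simps)
    also have "\<dots> = 4 * int d"
      using G_sum[of i] G_sum[of k] G_orth[of i k] lt ik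
      by (simp add: sum.distrib sum_subtractf)
    finally show ?thesis by simp
  qed
  then have "cover_free_family 1 1 d (4*d-1) (4*d-1) {1..<4*d} B"
    unfolding cover_free_family_1_1_iff by (auto simp: B_def)
  then show ?thesis by blast
qed

theorem theorem5:
  fixes d :: nat
  assumes "d > 0"
    and "\<exists>H. hadamard_matrix (4 * d) H"
  shows "cff_number 1 1 d (4 * d - 1) = 4 * d - 1"
  unfolding cff_number_def
proof (rule Least_equality)
  show "\<exists>(X :: nat set) B. cover_free_family 1 1 d (4*d-1) (4*d-1) X B"
    using assms hadamard_matrix_cover_free_family by blast
next
  fix n assume "\<exists>(X :: nat set) B. cover_free_family 1 1 d n (4*d-1) X B"
  then obtain X :: "nat set" and B where "cover_free_family 1 1 d n (4*d-1) X B"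
    by blast
  moreover have "odd (4*d-1)" "1 < 4*d-1"
    using assms(1) by auto
  ultimately have "4 * d * (4*d-1) \<le> n * (4*d-1+1)"
    by (rule cover_free_family_1_1_lower_bound)
  then have "4 * d * (4*d-1) \<le> 4 * d * n"
    using assms(1) by (simp add: mult.commute)
  then show "4*d-1 \<le> n"
    using assms(1) by simp
qed

end
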